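(* Let $w_\epsilon(r,t)=r^{\sigma(\epsilon)}\phi(t,\epsilon)+\overline{r^{\sigma(\epsilon)}\psi(t,\epsilon)}$ be a family of basic solutions of $\mathcal{L}_\epsilon$, depending continuously on $\epsilon\in\mathbb{R}$, with $\mathrm{Char}(w_\epsilon)=(\sigma(\epsilon),j)$. Then for every $\epsilon$ the operator $\mathcal{L}_\epsilon^*$ has a basic solution \[ w^\star_\epsilon(r,t)=r^{-\sigma(\epsilon)}X(t,\epsilon)+\overline{r^{-\sigma(\epsilon)}Z(t,\epsilon)} \] with $|X|>|Z|$ and $\mathrm{Char}(w^\star_\epsilon)=(-\sigma(\epsilon),-j)$.
   Context: Fix $a>0$, $b\in\mathbb{R}\setminus\{0\}$, $\nu\in[0,1)$, an integer $k\ge 2$ and $c\in C^k(\mathbb{S}^1,\mathbb{C})$ (functions on $\mathbb{S}^1$ are $2\pi$-periodic functions of $t\in\mathbb{R}$). For $\epsilon\in\mathbb{R}$ put $\lambda_\epsilon=a+ib\epsilon$, $L_\epsilon=\lambda_\epsilon\partial_t-ir\partial_r$ on $(0,\infty)\times\mathbb{S}^1$, $\mathcal{L}_\epsilon u=L_\epsilon u+i\lambda_\epsilon\nu u-c(t)\bar u$ and $\mathcal{L}^*_\epsilon v=-\big(L_\epsilon v-i\lambda_\epsilon\nu v+\overline{c(t)}\,\bar v\big)$. A basic solution of $\mathcal{L}_\epsilon$ (resp. $\mathcal{L}^*_\epsilon$) is a nontrivial solution $w$ of $\mathcal{L}_\epsilon w=0$ (resp. $\mathcal{L}^*_\epsilon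 w=0$) on $(0,\infty)\times\mathbb{S}^1$ of the form $w=r^\sigma\phi(t)+\overline{r^\sigma\psi(t)}$ with $\sigma\in\mathbb{C}$, $\phi,\psi$ $2\pi$-periodic. Such $w$ can be written with $|\phi|>|\psi|$ everywhere when $\sigma\notin\mathbb{R}$ (replacing $(\sigma,\phi,\psi)$ by $(\bar\sigma,\bar\psi,\bar\phi)$ if necessary), and as $w=r^\sigma f$ with $f$ nowhere zero when $\sigma\in\mathbb{R}$; the exponent of $w$ is this $\sigma$, its winding number $\mathrm{Ind}(w)$ is the winding number about $0$ of $\phi$ (resp. $f$), and $\mathrm{Char}(w)=(\sigma,\mathrm{Ind}(w))$. *)

theory Defs
  imports "HOL-Analysis.Analysis"
begin

text \<open>Functions on the circle are 2pi-periodic functions of t :: real.\<close>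
definition periodic2pi :: "(real \<Rightarrow> 'a) \<Rightarrow> bool" where
  "periodic2pi f \<longleftrightarrow> (\<forall>t. f (t + 2 * pi) = f t)"

definition Ck_circle :: "nat \<Rightarrow> (real \<Rightarrow> complex) \<Rightarrow> bool" where
  "Ck_circle k c \<longleftrightarrow> periodic2pi c \<and>
     (\<exists>D :: nat \<Rightarrow> real \<Rightarrow> complex. D 0 = c \<and>
        (\<forall>i<k. \<forall>t. (D i has_vector_derivative D (Suc i) t) (at t)) \<and>
        continuous_on UNIV (D k))"

definition rpow :: "real \<Rightarrow> complex \<Rightarrow> complex" where
  "rpow r \<sigma> = (complex_of_real r) powr \<sigma>"

definition lam :: "real \<Rightarrow> real \<Rightarrow> real \<Rightarrow> complex" where
  "lam a b \<epsilon> = Complex a (b * \<epsilon>)"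

definition L_sol :: "real \<Rightarrow> real \<Rightarrow> real \<Rightarrow> (real \<Rightarrow> complex) \<Rightarrow> real
    \<Rightarrow> (real \<Rightarrow> real \<Rightarrow> complex) \<Rightarrow> bool" where
  "L_sol a b \<nu> c \<epsilon> u \<longleftrightarrow> (\<forall>r>0. \<forall>t. \<exists>Dr Dt.
     ((\<lambda>s. u s t) has_vector_derivative Dr) (at r) \<and>
     ((\<lambda>s. u r s) has_vector_derivative Dt) (at t) \<and>
     lam a b \<epsilon> * Dt - \<i> * complex_of_real r * Dr + \<i> * lam a b \<epsilon> * complex_of_real \<nu> * u r t
       - c t * cnj (u r t) = 0)"

definition Lstar_sol :: "real \<Rightarrow> real \<Rightarrow> real \<Rightarrow> (real \<Rightarrow> complex) \<Rightarrow> real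
    \<Rightarrow> (real \<Rightarrow> real \<Rightarrow> complex) \<Rightarrow> bool" where
  "Lstar_sol a b \<nu> c \<epsilon> v \<longleftrightarrow> (\<forall>r>0. \<forall>t. \<exists>Dr Dt.
     ((\<lambda>s. v s t) has_vector_derivative Dr) (at r) \<and>
     ((\<lambda>s. v r s) has_vector_derivative Dt) (at t) \<and>
     - (lam a b \<epsilon> * Dt - \<i> * complex_of_real r * Dr - \<i> * lam a b \<epsilon> * complex_of_real \<nu> * v r t
       + cnj (c t) * cnj (v r t)) = 0)"

definition basic_sol :: "((real \<Rightarrow> real \<Rightarrow> complex) \<Rightarrow> bool) \<Rightarrow> (real \<Rightarrow> real \<Rightarrow> complex) \<Rightarrow> bool" where
  "basic_sol S w \<longleftrightarrow> S w \<and> (\<exists>r>0. \<exists>t. w r t \<noteq> 0) \<and>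
     (\<exists>\<sigma> \<phi> \<psi>. periodic2pi \<phi> \<and> periodic2pi \<psi> \<and>
        (\<forall>r>0. \<forall>t. w r t = rpow r \<sigma> * \<phi> t + cnj (rpow r \<sigma> * \<psi> t)))"

definition winding_num :: "(real \<Rightarrow> complex) \<Rightarrow> int \<Rightarrow> bool" where
  "winding_num f j \<longleftrightarrow> continuous_on UNIV f \<and> (\<forall>t. f t \<noteq> 0) \<and>
     (\<exists>\<theta>. continuous_on UNIV \<theta> \<and>
        (\<forall>t. f t = complex_of_real (norm (f t)) * exp (\<i> * complex_of_real (\<theta> t))) \<and>
        \<theta> (2 * pi) - \<theta> 0 = 2 * pi * of_int j)"

definition has_char :: "(real \<Rightarrow> real \<Rightarrow> complex) \<Rightarrow> complex \<Rightarrow> int \<Rightarrow> bool" where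
  "has_char w \<sigma> j \<longleftrightarrow>
     (if Im \<sigma> \<noteq> 0 then
        (\<exists>\<phi> \<psi>. periodic2pi \<phi> \<and> periodic2pi \<psi> \<and>
           (\<forall>r>0. \<forall>t. w r t = rpow r \<sigma> * \<phi> t + cnj (rpow r \<sigma> * \<psi> t)) \<and>
           (\<forall>t. norm (\<psi> t) < norm (\<phi> t)) \<and> winding_num \<phi> j)
      else
        (\<exists>f. periodic2pi f \<and> (\<forall>r>0. \<forall>t. w r t = rpow r \<sigma> * f t) \<and>
           (\<forall>t. f t \<noteq> 0) \<and> winding_num f j))"

end

theory Submission
  imports Defs
begin

text \<open>
  Fix \<open>\<epsilon>\<close> and write \<open>\<lambda>\<close> for \<open>\<lambda>\<^sub>\<epsilon>\<close>. If \<open>\<sigma>\<close> is not real, \<open>(\<phi>, \<psi>)\<close> is a periodic solution of a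
  linear system \<open>y' = M y\<close>, and \<open>(p, q) = (\<lambda> X, cnj \<lambda> Z)\<close> has to be a periodic solution of
  \<open>y' = - M\<^sup>T y\<close>. The pairing \<open>p \<phi> + q \<psi>\<close> is then constant, and since \<open>\<phi>\<close> has no zero the adjoint
  system reduces to a scalar equation, which has a periodic solution for the constant \<open>1\<close> or a
  nowhere vanishing one for the constant \<open>0\<close>. At an extremum of \<open>|\<phi>|\<^sup>2 - |\<psi>|\<^sup>2\<close> one has
  \<open>Re M\<^sub>1\<^sub>1 |\<phi>|\<^sup>2 = Re M\<^sub>2\<^sub>2 |\<psi>|\<^sup>2\<close>, and the same relation holds for \<open>p, q\<close> at the minimum of
  \<open>|p|\<^sup>2 - |q|\<^sup>2\<close>; as \<open>Re M\<^sub>1\<^sub>1 \<noteq> Re M\<^sub>2\<^sub>2\<close> when \<open>Im \<sigma> \<noteq> 0\<close>, the two relations and \<open>|\<psi>| < |\<phi>|\<close>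
  force \<open>|q| < |p|\<close>. This excludes the constant \<open>0\<close>, and \<open>p \<phi> + q \<psi> = 1\<close> confines \<open>p \<phi>\<close> to a half
  plane, so the winding numbers of \<open>p\<close> and \<open>\<phi>\<close> are opposite.
  If \<open>\<sigma>\<close> is real and \<open>w = r\<^sup>\<sigma> f\<close>, the invariant is \<open>Re (\<lambda> f X)\<close>, and the same reduction gives a
  periodic \<open>X\<close> for which \<open>\<lambda> f X\<close> avoids the nonpositive real axis.
\<close>

section \<open>Scalar linear equations with periodic coefficients\<close>

lemma antiderivative_on_line:
  fixes f :: "real \<Rightarrow> 'a::banach"
  assumes "continuous_on UNIV f"
  obtains F where "\<And>t. (F has_vector_derivative f t) (at t)"
proof
  \<comment> \<open>This is the signed integral from \<open>0\<close> to \<open>t\<close>: for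
    either sign of \<open>t\<close>, one of the two intervals is empty or a single point.\<close>
  define F where "F t = integral {0..t} f - integral {t..0} f" for t
  have int: "f integrable_on {u..v}" for u v
    by (rule integrable_continuous_real) (rule continuous_on_subset[OF assms], simp)
  fix t :: real
  \<comment> \<open>\<open>{-n..n}\<close> has \<open>t\<close> in its interior. On it
    \<open>F\<close> differs by a constant from the integral with lower limit \<open>-n\<close>, to
    which the fundamental theorem on a compact interval applies.\<close>
  define n where "n = \<bar>t\<bar> + 1"
  have F: "integral {-n..s} f - integral {-n..0} f = F s" if "s \<in> {-n<..<n}" for s
  proof (cases "s \<ge> 0")
    case True
    then show ?thesis
      using Henstock_Kurzweil_Integration.integral_combine[of "-n" 0 s f] int that
      by (cases "s = 0") (auto simp: F_def algebra_simps)
  next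
    case False
    then show ?thesis
      using Henstock_Kurzweil_Integration.integral_combine[of "-n" s 0 f] int that
      by (auto simp: F_def algebra_simps)
  qed
  have t: "t \<in> {-n<..<n}" by (auto simp: n_def)
  have "((\<lambda>s. integral {-n..s} f) has_vector_derivative f t) (at t within {-n..n})"
    by (rule integral_has_vector_derivative) (use t in \<open>auto intro: continuous_on_subset[OF assms]\<close>)
  then have "((\<lambda>s. integral {-n..s} f) has_vector_derivative f t) (at t)"
    using t by (simp add: at_within_Icc_at)
  then have "((\<lambda>s. integral {-n..s} f - integral {-n..0} f) has_vector_derivative f t) (at t)"
    by (auto intro!: derivative_eq_intros)
  then show "(F has_vector_derivative f t) (at t)"
    by (rule has_vector_derivative_transform_within_open[of _ _ _ "{-n<..<n}"]) (use t F in auto)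
qed

lemma has_vector_derivative_zero_const:
  fixes F :: "real \<Rightarrow> 'a::real_normed_vector"
  assumes "\<And>t. (F has_vector_derivative 0) (at t)"
  shows "F s = F t"
proof -
  have "\<And>x. x \<in> UNIV \<Longrightarrow> (F has_derivative (\<lambda>h. 0)) (at x within UNIV)"
    using assms by (auto simp: has_vector_derivative_def)
  then show ?thesis
    by (rule has_derivative_zero_unique[OF convex_UNIV]) auto
qed

lemma has_vector_derivative_exp:
  fixes A :: "real \<Rightarrow> 'a::{real_normed_field,banach}"
  assumes "(A has_vector_derivative d) (at t)"
  shows "((\<lambda>t. exp (A t)) has_vector_derivative d * exp (A t)) (at t)"
  using field_vector_diff_chain_at[OF assms DERIV_exp] by (simp add: o_def)

lemma has_vector_derivative_shift:
  assumes "\<And>t. (A has_vector_derivative d t) (at t)"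
  shows "((\<lambda>t. A (t + p)) has_vector_derivative d (t + p)) (at t)"
proof -
  have "((\<lambda>t. t + p) has_vector_derivative 1) (at t)"
    by (auto intro!: derivative_eq_intros)
  from vector_diff_chain_at[OF this assms] show ?thesis by (simp add: o_def)
qed

text \<open>Floquet alternative. An antiderivative \<open>A\<close> of \<open>\<alpha>\<close> grows
  by a constant \<open>m\<close> over each period. If \<open>exp m = 1\<close>, then
  \<open>exp A\<close> is itself periodic and never zero; otherwise the constant of integration in
  the variation-of-constants formula can be chosen to make that solution periodic. The type is
  generic because the equation is complex for a non-real exponent and real for a real one.\<close>

lemma periodic_scalar_ode:
  fixes \<alpha> \<beta> :: "real \<Rightarrow> 'a::{real_normed_field,banach}"
  assumes \<alpha>: "continuous_on UNIV \<alpha>" "periodic2pi \<alpha>"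
    and \<beta>: "continuous_on UNIV \<beta>" "periodic2pi \<beta>"
  obtains (inhomogeneous) y where "periodic2pi y"
      "\<And>t. (y has_vector_derivative \<alpha> t * y t + \<beta> t) (at t)"
  | (homogeneous) y where "periodic2pi y" "\<And>t. y t \<noteq> 0"
      "\<And>t. (y has_vector_derivative \<alpha> t * y t) (at t)"
proof -
  obtain A where A: "\<And>t. (A has_vector_derivative \<alpha> t) (at t)"
    using antiderivative_on_line[OF \<alpha>(1)] by blast
  define m where "m = A (2 * pi) - A 0"
  have "((\<lambda>t. A (t + 2 * pi) - A t) has_vector_derivative \<alpha> (t + 2 * pi) - \<alpha> t) (at t)" for t
    by (intro has_vector_derivative_diff has_vector_derivative_shift A)
  then have "((\<lambda>t. A (t + 2 * pi) - A t) has_vector_derivative 0) (at t)" for t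
    using \<alpha>(2) by (simp add: periodic2pi_def)
  from has_vector_derivative_zero_const[OF this, of _ 0]
  have Aper: "A (t + 2 * pi) = A t + m" for t
    by (simp add: m_def algebra_simps)
  have contA: "continuous_on UNIV A"
    using A has_vector_derivative_continuous continuous_at_imp_continuous_on by blast
  show ?thesis
  proof (cases "exp m = 1")
    case True
    show ?thesis
    proof (rule homogeneous)
      show "periodic2pi (\<lambda>t. exp (A t))"
        using True by (simp add: periodic2pi_def Aper exp_add)
    qed (auto intro: has_vector_derivative_exp A)
  next
    case False
    have "continuous_on UNIV (\<lambda>t. \<beta> t * exp (- A t))"
      by (intro continuous_intros contA \<beta>)
    then obtain B where B: "\<And>t. (B has_vector_derivative \<beta> t * exp (- A t)) (at t)"
      using antiderivative_on_line by blast
    define d where "d = B (2 * pi) - exp (- m) * B 0"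
    have "((\<lambda>t. B (t + 2 * pi) - exp (- m) * B t) has_vector_derivative
        \<beta> (t + 2 * pi) * exp (- A (t + 2 * pi)) - exp (- m) * (\<beta> t * exp (- A t))) (at t)" for t
      by (intro has_vector_derivative_diff has_vector_derivative_shift B
          has_vector_derivative_mult_right)
    moreover have "\<beta> (t + 2 * pi) * exp (- A (t + 2 * pi)) = exp (- m) * (\<beta> t * exp (- A t))" for t
      using \<beta>(2) by (simp add: periodic2pi_def Aper exp_minus exp_add exp_diff divide_inverse)
    ultimately have "((\<lambda>t. B (t + 2 * pi) - exp (- m) * B t) has_vector_derivative 0) (at t)" for t
      by simp
    from has_vector_derivative_zero_const[OF this, of _ 0]
    have Bper: "B (t + 2 * pi) = exp (- m) * B t + d" for t
      by (simp add: d_def algebra_simps)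
    \<comment> \<open>Shifting by one period sends \<open>exp (A t) * (B t + C)\<close> to
      \<open>exp (A t) * (B t + exp m * (d + C))\<close>, so \<open>C\<close> is the fixed point of
      \<open>x \<mapsto> exp m * (d + x)\<close>.\<close>
    define C where "C = exp m * d / (1 - exp m)"
    have C: "exp m * (d + C) = C"
      using False by (simp add: C_def field_simps)
    show ?thesis
    proof (rule inhomogeneous)
      have "exp (A t + m) * (exp (- m) * B t + d + C) = exp (A t) * (B t + exp m * (d + C))" for t
        by (simp add: exp_add exp_minus field_simps)
      then show "periodic2pi (\<lambda>t. exp (A t) * (B t + C))"
        by (simp add: periodic2pi_def Aper Bper C)
      fix t
      have "((\<lambda>t. exp (A t) * (B t + C)) has_vector_derivative
          exp (A t) * (\<beta> t * exp (- A t) + 0) + \<alpha> t * exp (A t) * (B t + C)) (at t)"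
        by (intro has_vector_derivative_mult has_vector_derivative_exp A has_vector_derivative_add B
            has_vector_derivative_const)
      then show "((\<lambda>t. exp (A t) * (B t + C)) has_vector_derivative
          \<alpha> t * (exp (A t) * (B t + C)) + \<beta> t) (at t)"
        by (simp add: exp_minus mult_ac add.commute)
    qed
  qed
qed

section \<open>Winding numbers\<close>

text \<open>Off the nonpositive real axis the principal argument is continuous, so
  \<open>Arg (q t)\<close> is a continuous periodic function and contributes no winding. Up to it
  and the constant \<open>Arg l\<close>, the argument of \<open>g = q / (l f)\<close> is minus that
  of \<open>f\<close>.\<close>

lemma winding_num_reciprocal:
  fixes f g q :: "real \<Rightarrow> complex"
  assumes "winding_num f j" "periodic2pi q" "continuous_on UNIV g" "continuous_on UNIV q"
    and q: "\<And>t. q t \<notin> \<real>\<^sub>\<le>\<^sub>0" and "l \<noteq> 0" and fg: "\<And>t. l * f t * g t = q t"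
  shows "winding_num g (- j)"
proof -
  obtain \<theta> where f: "\<And>t. f t \<noteq> 0" and \<theta>: "continuous_on UNIV \<theta>"
    "\<And>t. f t = complex_of_real (norm (f t)) * exp (\<i> * complex_of_real (\<theta> t))"
    "\<theta> (2 * pi) - \<theta> 0 = 2 * pi * of_int j"
    using assms(1) by (auto simp: winding_num_def)
  have q0: "q t \<noteq> 0" for t using q[of t] by auto
  have g0: "g t \<noteq> 0" for t using q0[of t] fg[of t] by auto
  have polar: "z = complex_of_real (norm z) * exp (\<i> * complex_of_real (Arg z))" if "z \<noteq> 0" for z
    using Arg_eq[OF that] .
  define \<eta> where "\<eta> t = Arg (q t) - Arg l - \<theta> t" for t
  have "continuous_on UNIV (\<lambda>t. Arg (q t))"
    using assms(4) q by (simp add: continuous_on_eq_continuous_at continuous_at_Arg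
        isCont_o2)
  then have "continuous_on UNIV \<eta>"
    unfolding \<eta>_def by (intro continuous_on_diff continuous_on_const \<theta>)
  moreover have "g t = complex_of_real (norm (g t)) * exp (\<i> * complex_of_real (\<eta> t))" for t
  proof -
    have g: "g t = q t / (l * f t)" using fg[of t] f[of t] assms(6) by (simp add: field_simps)
    have "g t = (norm (q t) * exp (\<i> * Arg (q t))) /
        ((norm l * exp (\<i> * Arg l)) * (norm (f t) * exp (\<i> * \<theta> t)))"
      unfolding g using polar[OF q0[of t]] polar[OF assms(6)] \<theta>(2)[of t] by simp
    also have "\<dots> = norm (g t) * exp (\<i> * \<eta> t)"
      unfolding g \<eta>_def by (simp add: norm_divide norm_mult exp_diff exp_add algebra_simps)
    finally show ?thesis .
  qed
  moreover have "\<eta> (2 * pi) - \<eta> 0 = 2 * pi * of_int (- j)"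
    using assms(2)[unfolded periodic2pi_def, rule_format, of 0] \<theta>(3) by (simp add: \<eta>_def)
  ultimately show ?thesis
    unfolding winding_num_def using assms(3) g0 by blast
qed

section \<open>The periodic system and its adjoint\<close>

lemma has_vector_derivative_imp_continuous_on_UNIV:
  assumes "\<And>t. (f has_vector_derivative f' t) (at t)"
  shows "continuous_on UNIV f"
  using assms has_vector_derivative_continuous continuous_at_imp_continuous_on by blast

text \<open>Compactness gives a minimum over one period, and every real can be moved into that
  period by an integer number of shifts.\<close>

lemma periodic2pi_attains_min:
  fixes E :: "real \<Rightarrow> real"
  assumes "periodic2pi E" "continuous_on UNIV E"
  obtains t where "\<And>u. E t \<le> E u"
proof -
  obtain t where t: "\<And>u. u \<in> {0..2*pi} \<Longrightarrow> E t \<le> E u"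
    using continuous_attains_inf[of "{0..2*pi}" E] continuous_on_subset[OF assms(2)]
    by (metis atLeastatMost_empty_iff2 compact_Icc pi_ge_zero subset_UNIV
        mult_nonneg_nonneg zero_le_numeral)
  have shift: "E (u + of_int n * (2*pi)) = E u" for u n
  proof (induction n rule: int_induct[where k = 0])
    case (step1 i)
    have "E (u + of_int i * (2*pi) + 2*pi) = E (u + of_int i * (2*pi))"
      using assms(1) by (simp only: periodic2pi_def)
    then show ?case using step1 by (simp add: algebra_simps)
  next
    case (step2 i)
    have "E (u + of_int (i - 1) * (2*pi) + 2*pi) = E (u + of_int (i - 1) * (2*pi))"
      using assms(1) by (simp only: periodic2pi_def)
    then show ?case using step2 by (simp add: algebra_simps)
  qed simp
  have "E t \<le> E u" for u
  proof -
    define n where "n = \<lfloor>u / (2*pi)\<rfloor>"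
    have "of_int n \<le> u / (2*pi)" "u / (2*pi) < of_int n + 1"
      unfolding n_def by linarith+
    then have "of_int n * (2*pi) \<le> u" "u \<le> of_int n * (2*pi) + 2*pi"
      by (simp_all add: field_simps)
    then have "E t \<le> E (u + of_int (- n) * (2*pi))" by (intro t) auto
    then show ?thesis by (simp only: shift)
  qed
  then show ?thesis using that by blast
qed

text \<open>The coupling terms are mutually conjugate, so they cancel in the derivative of
  \<open>|x|\<^sup>2 - |z|\<^sup>2\<close>.\<close>

lemma energy_balance:
  fixes x z B :: "real \<Rightarrow> complex"
  assumes "periodic2pi x" "periodic2pi z"
    and x: "\<And>t. (x has_vector_derivative A * x t + B t * z t) (at t)"
    and z: "\<And>t. (z has_vector_derivative cnj (B t) * x t + D * z t) (at t)"
  obtains t where "Re A * (norm (x t))\<^sup>2 = Re D * (norm (z t))\<^sup>2"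
    "\<And>u. (norm (x t))\<^sup>2 - (norm (z t))\<^sup>2 \<le> (norm (x u))\<^sup>2 - (norm (z u))\<^sup>2"
proof -
  define E where "E t = (norm (x t))\<^sup>2 - (norm (z t))\<^sup>2" for t
  have sq: "((\<lambda>t. (norm (f t))\<^sup>2) has_real_derivative 2 * (f t \<bullet> f')) (at t)"
    if "(f has_vector_derivative f') (at t)" for f :: "real \<Rightarrow> complex" and f' t
    using that unfolding has_vector_derivative_def has_field_derivative_def power2_norm_eq_inner
    by (auto intro!: derivative_eq_intros simp: inner_commute)
  have E': "(E has_real_derivative 2 * (Re A * (norm (x t))\<^sup>2 - Re D * (norm (z t))\<^sup>2)) (at t)" for t
  proof -
    have "(E has_real_derivative 2 * (x t \<bullet> (A * x t + B t * z t))
        - 2 * (z t \<bullet> (cnj (B t) * x t + D * z t))) (at t)"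
      unfolding E_def by (intro DERIV_diff sq x z)
    also have "2 * (x t \<bullet> (A * x t + B t * z t)) - 2 * (z t \<bullet> (cnj (B t) * x t + D * z t))
        = 2 * (Re A * (norm (x t))\<^sup>2 - Re D * (norm (z t))\<^sup>2)"
      unfolding cmod_power2 inner_complex_def by (simp add: algebra_simps power2_eq_square)
    finally show ?thesis .
  qed
  have "continuous_on UNIV E" using E' DERIV_isCont continuous_at_imp_continuous_on by blast
  moreover have "periodic2pi E" using assms(1,2) by (simp add: E_def periodic2pi_def)
  ultimately obtain t where t: "\<And>u. E t \<le> E u" using periodic2pi_attains_min by blast
  \<comment> \<open>The relation is the vanishing of \<open>E'\<close> at a minimum. Minimality is
    exported as well, because a positive value of \<open>E\<close> at \<open>t\<close> then holds
    everywhere.\<close>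
  have "2 * (Re A * (norm (x t))\<^sup>2 - Re D * (norm (z t))\<^sup>2) = 0"
    using DERIV_local_min[OF E', of 1] t by auto
  then show ?thesis using that[of t] t by (simp add: E_def)
qed

text \<open>Reduction of order: along the known solution \<open>(\<phi>, \<psi>)\<close> the pairing \<open>p \<phi> + q \<psi>\<close> is constant,
  which eliminates \<open>p\<close> and leaves a scalar equation for \<open>q\<close>.\<close>

lemma periodic_adjoint_system:
  fixes \<phi> \<psi> B :: "real \<Rightarrow> complex"
  assumes per: "periodic2pi \<phi>" "periodic2pi \<psi>" "periodic2pi B" and B: "continuous_on UNIV B"
    and \<phi>: "\<And>t. (\<phi> has_vector_derivative A * \<phi> t + B t * \<psi> t) (at t)"
    and \<psi>: "\<And>t. (\<psi> has_vector_derivative cnj (B t) * \<phi> t + D * \<psi> t) (at t)"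
    and \<phi>0: "\<And>t. \<phi> t \<noteq> 0"
  obtains p q K where "periodic2pi p" "periodic2pi q"
    "\<And>t. (p has_vector_derivative - A * p t - cnj (B t) * q t) (at t)"
    "\<And>t. (q has_vector_derivative - B t * p t - D * q t) (at t)"
    "\<And>t. p t * \<phi> t + q t * \<psi> t = K"
    "K = 0 \<or> K = 1" "\<And>t. p t \<noteq> 0 \<or> q t \<noteq> 0"
proof -
  note adjointI = that
  note cont = has_vector_derivative_imp_continuous_on_UNIV[OF \<phi>]
    has_vector_derivative_imp_continuous_on_UNIV[OF \<psi>]
  \<comment> \<open>Substituting \<open>p = (K - q \<psi>) / \<phi>\<close> into
    \<open>q' = - B p - D q\<close> gives \<open>q' = \<alpha> q + K \<beta>\<close>.\<close>
  define \<alpha> where "\<alpha> t = B t * \<psi> t / \<phi> t - D" for t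
  define \<beta> where "\<beta> t = - B t / \<phi> t" for t
  \<comment> \<open>Both outcomes of the scalar alternative are treated at once:
    \<open>K = 1\<close> is the inhomogeneous one, \<open>K = 0\<close> the homogeneous one. The
    pair \<open>(p, y)\<close> never vanishes, by the pairing when \<open>K = 1\<close> and by
    \<open>y \<noteq> 0\<close> when \<open>K = 0\<close>.\<close>
  have main: thesis if y: "periodic2pi y" "\<And>t. (y has_vector_derivative \<alpha> t * y t + K * \<beta> t) (at t)"
      "K = 0 \<or> K = 1" "K = 0 \<Longrightarrow> \<forall>t. y t \<noteq> 0" for y K
  proof -
    define p where "p t = (K - y t * \<psi> t) / \<phi> t" for t
    have pK: "p t * \<phi> t + y t * \<psi> t = K" for t
      using \<phi>0[of t] by (simp add: p_def)
    have y': "\<alpha> t * y t + K * \<beta> t = - B t * p t - D * y t" for t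
      using \<phi>0[of t] by (simp add: p_def \<alpha>_def \<beta>_def field_simps)
    show thesis
    proof (rule adjointI[of p y K])
      show "periodic2pi p" using y(1) per by (simp add: p_def periodic2pi_def)
      fix t
      show "(y has_vector_derivative - B t * p t - D * y t) (at t)" using y(2)[of t] y' by simp
      have inv: "((\<lambda>t. inverse (\<phi> t)) has_vector_derivative
          (A * \<phi> t + B t * \<psi> t) * (- (inverse (\<phi> t) * inverse (\<phi> t)))) (at t)"
        using field_vector_diff_chain_at[OF \<phi> DERIV_inverse[OF \<phi>0], of t]
        by (simp add: o_def power2_eq_square)
      have "(p has_vector_derivative
           (K - y t * \<psi> t) * ((A * \<phi> t + B t * \<psi> t) * (- (inverse (\<phi> t) * inverse (\<phi> t))))
           + (0 - (y t * (cnj (B t) * \<phi> t + D * \<psi> t) + (- B t * p t - D * y t) * \<psi> t)) * inverse (\<phi> t)) (at t)"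
        unfolding p_def divide_inverse
        by (intro has_vector_derivative_mult has_vector_derivative_diff has_vector_derivative_const
            \<psi> inv) (use y(2)[of t] y'[of t] in \<open>simp add: p_def divide_inverse\<close>)
      also have "(K - y t * \<psi> t) * ((A * \<phi> t + B t * \<psi> t) * (- (inverse (\<phi> t) * inverse (\<phi> t))))
           + (0 - (y t * (cnj (B t) * \<phi> t + D * \<psi> t) + (- B t * p t - D * y t) * \<psi> t)) * inverse (\<phi> t)
           = - A * p t - cnj (B t) * y t"
        using \<phi>0[of t] by (simp add: p_def field_simps)
      finally show "(p has_vector_derivative - A * p t - cnj (B t) * y t) (at t)" .
      show "p t \<noteq> 0 \<or> y t \<noteq> 0" using y(3,4) pK[of t] by auto
    qed (use y pK in auto)
  qed
  have 1: "continuous_on UNIV \<alpha>" "continuous_on UNIV \<beta>"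
    unfolding \<alpha>_def \<beta>_def by (intro continuous_intros cont B; use \<phi>0 in auto)+
  have 2: "periodic2pi \<alpha>" "periodic2pi \<beta>"
    using per by (simp_all add: \<alpha>_def \<beta>_def periodic2pi_def)
  show thesis
  proof (rule periodic_scalar_ode[OF 1(1) 2(1) 1(2) 2(2)])
    fix y assume "periodic2pi y" "\<And>t. (y has_vector_derivative \<alpha> t * y t + \<beta> t) (at t)"
    then show thesis by (intro main[of y 1]) auto
  next
    fix y assume "periodic2pi y" "\<And>t. y t \<noteq> 0" "\<And>t. (y has_vector_derivative \<alpha> t * y t) (at t)"
    then show thesis by (intro main[of y 0]) auto
  qed
qed

text \<open>The adjoint system has the shape required by \<open>energy_balance\<close>, with
  \<open>- A\<close>, \<open>- cnj B\<close>, \<open>- D\<close> as coefficients. The energy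
  relations of the two systems form a homogeneous linear system for \<open>(Re A, Re D)\<close>,
  which is not \<open>(0, 0)\<close>, so its determinant must vanish;
  \<open>norm p \<le> norm q\<close> would make it positive.\<close>

lemma periodic_adjoint_dominant:
  fixes \<phi> \<psi> B :: "real \<Rightarrow> complex"
  assumes per: "periodic2pi \<phi>" "periodic2pi \<psi>" "periodic2pi B" and B: "continuous_on UNIV B"
    and \<phi>: "\<And>t. (\<phi> has_vector_derivative A * \<phi> t + B t * \<psi> t) (at t)"
    and \<psi>: "\<And>t. (\<psi> has_vector_derivative cnj (B t) * \<phi> t + D * \<psi> t) (at t)"
    and less: "\<And>t. norm (\<psi> t) < norm (\<phi> t)" and AD: "Re A \<noteq> Re D"
  obtains p q where "periodic2pi p" "periodic2pi q"
    "\<And>t. (p has_vector_derivative - A * p t - cnj (B t) * q t) (at t)"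
    "\<And>t. (q has_vector_derivative - B t * p t - D * q t) (at t)"
    "\<And>t. norm (q t) < norm (p t)" "\<And>t. Re (p t * \<phi> t) > 0"
proof -
  have \<phi>0: "\<phi> t \<noteq> 0" for t using less[of t] by auto
  obtain p q K where pq: "periodic2pi p" "periodic2pi q"
    "\<And>t. (p has_vector_derivative - A * p t - cnj (B t) * q t) (at t)"
    "\<And>t. (q has_vector_derivative - B t * p t - D * q t) (at t)"
    "\<And>t. p t * \<phi> t + q t * \<psi> t = K"
    "K = 0 \<or> K = 1" "\<And>t. p t \<noteq> 0 \<or> q t \<noteq> 0"
    by (rule periodic_adjoint_system[OF per B \<phi> \<psi> \<phi>0]) blast+
  obtain s where s: "Re A * (norm (\<phi> s))\<^sup>2 = Re D * (norm (\<psi> s))\<^sup>2"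
    by (rule energy_balance[OF per(1,2) \<phi> \<psi>]) blast
  have "(p has_vector_derivative - A * p u + - cnj (B u) * q u) (at u)"
    "(q has_vector_derivative cnj (- cnj (B u)) * p u + - D * q u) (at u)" for u
    using pq(3,4)[of u] by simp_all
  then obtain t where t: "Re (- A) * (norm (p t))\<^sup>2 = Re (- D) * (norm (q t))\<^sup>2"
    and min: "\<And>u. (norm (p t))\<^sup>2 - (norm (q t))\<^sup>2 \<le> (norm (p u))\<^sup>2 - (norm (q u))\<^sup>2"
    by (rule energy_balance[OF pq(1,2)]) blast
  have "norm (q t) < norm (p t)"
  proof (rule ccontr)
    assume "\<not> ?thesis"
    then have le: "norm (p t) \<le> norm (q t)" and q0: "norm (q t) > 0"
      using pq(7)[of t] by auto
    have "(norm (p t))\<^sup>2 * (norm (\<psi> s))\<^sup>2 \<le> (norm (q t))\<^sup>2 * (norm (\<psi> s))\<^sup>2"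
      using le by (intro mult_right_mono power_mono) auto
    also have "\<dots> < (norm (q t))\<^sup>2 * (norm (\<phi> s))\<^sup>2"
      using less[of s] q0 by (intro mult_strict_left_mono power_strict_mono) auto
    finally have det: "(norm (q t))\<^sup>2 * (norm (\<phi> s))\<^sup>2 - (norm (p t))\<^sup>2 * (norm (\<psi> s))\<^sup>2 \<noteq> 0" by simp
    have t': "Re A * (norm (p t))\<^sup>2 = Re D * (norm (q t))\<^sup>2" using t by simp
    have "Re A * ((norm (q t))\<^sup>2 * (norm (\<phi> s))\<^sup>2 - (norm (p t))\<^sup>2 * (norm (\<psi> s))\<^sup>2) = 0"
      using s t' by algebra
    moreover have "Re D * ((norm (q t))\<^sup>2 * (norm (\<phi> s))\<^sup>2 - (norm (p t))\<^sup>2 * (norm (\<psi> s))\<^sup>2) = 0"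
      using s t' by algebra
    ultimately show False using det AD by simp
  qed
  \<comment> \<open>The difference of squares is positive at its minimum, hence everywhere.\<close>
  then have "(norm (q t))\<^sup>2 < (norm (p t))\<^sup>2" by (intro power_strict_mono) auto
  then have "(norm (q u))\<^sup>2 < (norm (p u))\<^sup>2" for u using min[of u] by linarith
  then have qp: "norm (q u) < norm (p u)" for u
    using power2_less_imp_less norm_ge_zero by blast
  have lt: "norm (q u * \<psi> u) < norm (p u * \<phi> u)" for u
    unfolding norm_mult using qp[of u] less[of u] by (intro mult_strict_mono') auto
  \<comment> \<open>For \<open>K = 0\<close> the products \<open>p \<phi>\<close> and
    \<open>q \<psi>\<close> would have equal modulus, against \<open>lt\<close>.\<close>
  have "K = 1"
  proof (rule ccontr)
    assume "K \<noteq> 1"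
    then have "p 0 * \<phi> 0 = - (q 0 * \<psi> 0)" using pq(5,6) by (simp add: eq_neg_iff_add_eq_0)
    then show False using lt[of 0] by (metis norm_minus_cancel less_irrefl)
  qed
  have "Re (p u * \<phi> u) > 0" for u
  proof -
    define z where "z = p u * \<phi> u"
    have "q u * \<psi> u = 1 - z" using pq(5)[of u] \<open>K = 1\<close> by (simp add: z_def algebra_simps)
    \<comment> \<open>A point closer to \<open>1\<close> than to \<open>0\<close> has real part
      above \<open>1/2\<close>.\<close>
    then have "norm (1 - z) < norm z" using lt[of u] by (simp add: z_def)
    then have "(norm (1 - z))\<^sup>2 < (norm z)\<^sup>2" by (intro power_strict_mono) auto
    then show ?thesis
      unfolding z_def[symmetric] cmod_power2 by (simp add: power2_eq_square algebra_simps)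
  qed
  then show thesis using that pq(1-4) qp by blast
qed

text \<open>The equation is only real-linear, so the reduction is done over the reals. For
  \<open>h = l f g\<close> it reads \<open>h' = \<kappa> h - cnj (\<kappa> h)\<close>, which is
  purely imaginary. Hence \<open>Re h\<close> is a constant \<open>K\<close>, and
  \<open>y = Im h\<close> satisfies \<open>y' = 2 Re \<kappa> y + 2 K Im \<kappa>\<close>.\<close>

lemma periodic_adjoint_real:
  fixes f c :: "real \<Rightarrow> complex"
  assumes per: "periodic2pi f" "periodic2pi c" and c: "continuous_on UNIV c"
    and f: "\<And>t. (f has_vector_derivative A * f t + c t / l * cnj (f t)) (at t)"
    and f0: "\<And>t. f t \<noteq> 0" and l: "l \<noteq> 0"
  obtains g where "periodic2pi g"
    "\<And>t. (g has_vector_derivative - A * g t - cnj (c t) / l * cnj (g t)) (at t)"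
    "\<And>t. l * f t * g t \<notin> \<real>\<^sub>\<le>\<^sub>0"
proof -
  note adjointI = that
  note cont = has_vector_derivative_imp_continuous_on_UNIV[OF f]
  define \<kappa> where "\<kappa> t = c t * cnj (f t) / (l * f t)" for t
  have main: thesis if y: "periodic2pi y"
      "\<And>t. (y has_vector_derivative 2 * Re (\<kappa> t) * y t + K * (2 * Im (\<kappa> t))) (at t)"
      "K = 0 \<or> K = 1" "K = 0 \<Longrightarrow> \<forall>t. y t \<noteq> 0" for y :: "real \<Rightarrow> real" and K :: real
  proof -
    define g where "g t = Complex K (y t) / (l * f t)" for t
    have lfg: "l * f t * g t = Complex K (y t)" for t
      using f0[of t] l by (simp add: g_def)
    show thesis
    proof (rule adjointI[of g])
      show "periodic2pi g" using y(1) per by (simp add: g_def periodic2pi_def)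
      fix t
      have inv: "((\<lambda>t. inverse (f t)) has_vector_derivative
          (A * f t + c t / l * cnj (f t)) * (- (inverse (f t) * inverse (f t)))) (at t)"
        using field_vector_diff_chain_at[OF f DERIV_inverse[OF f0], of t]
        by (simp add: o_def power2_eq_square)
      define d where "d = 2 * Re (\<kappa> t) * y t + K * (2 * Im (\<kappa> t))"
      have "((\<lambda>t. Complex K (y t)) has_vector_derivative \<i> * d) (at t)"
        using y(2)[of t] unfolding d_def[symmetric] Complex_eq
        by (auto intro!: derivative_eq_intros has_vector_derivative_of_real
            simp: has_real_derivative_iff_has_vector_derivative)
      then have "((\<lambda>t. Complex K (y t) * (inverse l * inverse (f t))) has_vector_derivative
          Complex K (y t) * (inverse l * ((A * f t + c t / l * cnj (f t)) *
            (- (inverse (f t) * inverse (f t))))) + \<i> * d * (inverse l * inverse (f t))) (at t)"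
        by (intro has_vector_derivative_mult has_vector_derivative_mult_right inv)
      moreover have "\<i> * d = \<kappa> t * Complex K (y t) - cnj (\<kappa> t * Complex K (y t))"
        by (simp add: d_def complex_eq_iff algebra_simps)
      moreover have "Complex K (y t) * (inverse l * ((A * f t + c t / l * cnj (f t)) *
            (- (inverse (f t) * inverse (f t)))))
            + (\<kappa> t * Complex K (y t) - cnj (\<kappa> t * Complex K (y t))) * (inverse l * inverse (f t))
          = - A * g t - cnj (c t) / l * cnj (g t)"
        unfolding \<kappa>_def g_def using f0[of t] l by (simp add: field_simps)
      ultimately show "(g has_vector_derivative - A * g t - cnj (c t) / l * cnj (g t)) (at t)"
        by (simp add: g_def[abs_def] divide_inverse)
      \<comment> \<open>For \<open>K = 1\<close> the real part is \<open>1\<close>; for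
        \<open>K = 0\<close> the imaginary part \<open>y\<close> never vanishes.\<close>
      show "l * f t * g t \<notin> \<real>\<^sub>\<le>\<^sub>0"
        unfolding lfg using y(3,4) by (auto simp: complex_nonpos_Reals_iff)
    qed
  qed
  have \<kappa>: "continuous_on UNIV \<kappa>" "periodic2pi \<kappa>"
    unfolding \<kappa>_def using per f0 l by (auto intro!: continuous_intros cont c simp: periodic2pi_def)
  have 1: "continuous_on UNIV (\<lambda>t. 2 * Re (\<kappa> t))" "continuous_on UNIV (\<lambda>t. 2 * Im (\<kappa> t))"
    by (intro continuous_intros \<kappa>)+
  have 2: "periodic2pi (\<lambda>t. 2 * Re (\<kappa> t))" "periodic2pi (\<lambda>t. 2 * Im (\<kappa> t))"
    using \<kappa>(2) by (simp_all add: periodic2pi_def)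
  show thesis
  proof (rule periodic_scalar_ode[OF 1(1) 2(1) 1(2) 2(2)])
    fix y :: "real \<Rightarrow> real" assume "periodic2pi y"
      "\<And>t. (y has_vector_derivative 2 * Re (\<kappa> t) * y t + 2 * Im (\<kappa> t)) (at t)"
    then show thesis by (intro main[of y 1]) auto
  next
    fix y :: "real \<Rightarrow> real" assume "periodic2pi y" "\<And>t. y t \<noteq> 0"
      "\<And>t. (y has_vector_derivative 2 * Re (\<kappa> t) * y t) (at t)"
    then show thesis by (intro main[of y 0]) auto
  qed
qed

section \<open>Separation of variables\<close>

lemma rpow_eq_exp: "r > 0 \<Longrightarrow> rpow r \<sigma> = exp (\<sigma> * complex_of_real (ln r))"
  by (simp add: rpow_def powr_def Ln_of_real)

lemma rpow_1 [simp]: "rpow 1 \<sigma> = 1"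
  by (simp add: rpow_eq_exp)

lemma has_vector_derivative_rpow:
  assumes "r > 0"
  shows "((\<lambda>s. rpow s \<sigma>) has_vector_derivative \<sigma> * rpow r \<sigma> / complex_of_real r) (at r)"
proof -
  have "((\<lambda>s. \<sigma> * complex_of_real (ln s)) has_vector_derivative \<sigma> * complex_of_real (1 / r)) (at r)"
    using assms DERIV_ln_divide[OF assms]
    by (intro has_vector_derivative_mult_right has_vector_derivative_of_real)
      (simp add: has_real_derivative_iff_has_vector_derivative)
  from has_vector_derivative_exp[OF this]
  have "((\<lambda>s. exp (\<sigma> * complex_of_real (ln s))) has_vector_derivative
      \<sigma> * rpow r \<sigma> / complex_of_real r) (at r)"
    using assms by (simp add: rpow_eq_exp)
  then show ?thesis
    by (rule has_vector_derivative_transform_within_open[of _ _ _ "{0<..}"])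
      (use assms in \<open>auto simp: rpow_eq_exp\<close>)
qed

lemma separated_derivatives:
  assumes "(\<phi> has_vector_derivative \<phi>') (at t)" "(\<psi> has_vector_derivative \<psi>') (at t)" "r > 0"
  shows "((\<lambda>s. rpow s \<sigma> * \<phi> t + cnj (rpow s \<sigma> * \<psi> t)) has_vector_derivative
      (\<sigma> * rpow r \<sigma> * \<phi> t + cnj (\<sigma> * rpow r \<sigma> * \<psi> t)) / complex_of_real r) (at r)"
    and "((\<lambda>s. rpow r \<sigma> * \<phi> s + cnj (rpow r \<sigma> * \<psi> s)) has_vector_derivative
      rpow r \<sigma> * \<phi>' + cnj (rpow r \<sigma> * \<psi>')) (at t)"
proof -
  have "((\<lambda>s. rpow s \<sigma> * \<phi> t + cnj (rpow s \<sigma> * \<psi> t)) has_vector_derivative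
      \<sigma> * rpow r \<sigma> / complex_of_real r * \<phi> t + cnj (\<sigma> * rpow r \<sigma> / complex_of_real r * \<psi> t)) (at r)"
    by (intro has_vector_derivative_add has_vector_derivative_cnj has_vector_derivative_mult_left
        has_vector_derivative_rpow assms)
  then show "((\<lambda>s. rpow s \<sigma> * \<phi> t + cnj (rpow s \<sigma> * \<psi> t)) has_vector_derivative
      (\<sigma> * rpow r \<sigma> * \<phi> t + cnj (\<sigma> * rpow r \<sigma> * \<psi> t)) / complex_of_real r) (at r)"
    by (simp add: add_divide_distrib)
  show "((\<lambda>s. rpow r \<sigma> * \<phi> s + cnj (rpow r \<sigma> * \<psi> s)) has_vector_derivative
      rpow r \<sigma> * \<phi>' + cnj (rpow r \<sigma> * \<psi>')) (at t)"
    by (intro has_vector_derivative_add has_vector_derivative_cnj has_vector_derivative_mult_right assms)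
qed

text \<open>Sorts the equation by \<open>r^\<sigma>\<close> and its conjugate. The two brackets do
  not depend on \<open>r\<close>, so they can be isolated by varying the radius.\<close>

lemma L_sol_separated:
  assumes "L_sol a b \<nu> c \<epsilon> w" "r > 0"
    and w: "\<And>r t. r > 0 \<Longrightarrow> w r t = rpow r \<sigma> * \<phi> t + cnj (rpow r \<sigma> * \<psi> t)"
    and "(\<phi> has_vector_derivative \<phi>') (at t)" "(\<psi> has_vector_derivative \<psi>') (at t)"
  shows "rpow r \<sigma> * (lam a b \<epsilon> * \<phi>' - \<i> * \<sigma> * \<phi> t + \<i> * lam a b \<epsilon> * \<nu> * \<phi> t - c t * \<psi> t)
    + cnj (rpow r \<sigma>) * (lam a b \<epsilon> * cnj \<psi>' - \<i> * cnj \<sigma> * cnj (\<psi> t)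
        + \<i> * lam a b \<epsilon> * \<nu> * cnj (\<psi> t) - c t * cnj (\<phi> t)) = 0"
proof -
  obtain Dr Dt where D: "((\<lambda>s. w s t) has_vector_derivative Dr) (at r)"
    "((\<lambda>s. w r s) has_vector_derivative Dt) (at t)"
    and eq: "lam a b \<epsilon> * Dt - \<i> * complex_of_real r * Dr + \<i> * lam a b \<epsilon> * complex_of_real \<nu> * w r t
       - c t * cnj (w r t) = 0"
    using assms(1,2) unfolding L_sol_def by blast
  note sep = separated_derivatives[OF assms(4,5,2), of \<sigma>]
  have "((\<lambda>s. w s t) has_vector_derivative
      (\<sigma> * rpow r \<sigma> * \<phi> t + cnj (\<sigma> * rpow r \<sigma> * \<psi> t)) / complex_of_real r) (at r)"
    by (rule has_vector_derivative_transform_within_open[OF sep(1), of "{0<..}"])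
      (use assms(2) w in auto)
  then have Dr: "Dr = (\<sigma> * rpow r \<sigma> * \<phi> t + cnj (\<sigma> * rpow r \<sigma> * \<psi> t)) / complex_of_real r"
    using D(1) vector_derivative_unique_at by blast
  have Dt: "Dt = rpow r \<sigma> * \<phi>' + cnj (rpow r \<sigma> * \<psi>')"
    using D(2) sep(2) vector_derivative_unique_at w[OF assms(2)] by auto
  have rDr: "\<i> * complex_of_real r * Dr = \<i> * (\<sigma> * rpow r \<sigma> * \<phi> t + cnj (\<sigma> * rpow r \<sigma> * \<psi> t))"
    using assms(2) by (simp add: Dr)
  show ?thesis
    using eq unfolding rDr Dt w[OF assms(2)] by (simp add: algebra_simps)
qed

text \<open>Only the whole sum is required to vanish, not each bracket: for a real exponent the two
  powers coincide and the brackets merely cancel each other.\<close>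

lemma Lstar_sol_separated:
  assumes "\<And>t. (X has_vector_derivative X' t) (at t)" "\<And>t. (Z has_vector_derivative Z' t) (at t)"
    and eq: "\<And>r t. r > 0 \<Longrightarrow>
      rpow r \<sigma> * (lam a b \<epsilon> * X' t - \<i> * \<sigma> * X t - \<i> * lam a b \<epsilon> * \<nu> * X t + cnj (c t) * Z t)
      + cnj (rpow r \<sigma>) * (lam a b \<epsilon> * cnj (Z' t) - \<i> * cnj \<sigma> * cnj (Z t)
        - \<i> * lam a b \<epsilon> * \<nu> * cnj (Z t) + cnj (c t) * cnj (X t)) = 0"
  shows "Lstar_sol a b \<nu> c \<epsilon> (\<lambda>r t. rpow r \<sigma> * X t + cnj (rpow r \<sigma> * Z t))"
  unfolding Lstar_sol_def
proof (intro allI impI)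
  fix r t :: real assume r: "r > 0"
  let ?v = "\<lambda>r t. rpow r \<sigma> * X t + cnj (rpow r \<sigma> * Z t)"
  let ?Dr = "(\<sigma> * rpow r \<sigma> * X t + cnj (\<sigma> * rpow r \<sigma> * Z t)) / complex_of_real r"
  let ?Dt = "rpow r \<sigma> * X' t + cnj (rpow r \<sigma> * Z' t)"
  have "\<i> * complex_of_real r * ?Dr = \<i> * (\<sigma> * rpow r \<sigma> * X t + cnj (\<sigma> * rpow r \<sigma> * Z t))"
    using r by simp
  then have "- (lam a b \<epsilon> * ?Dt - \<i> * complex_of_real r * ?Dr
      - \<i> * lam a b \<epsilon> * complex_of_real \<nu> * ?v r t + cnj (c t) * cnj (?v r t)) = 0"
    using eq[OF r, of t] by (simp only:) (simp add: algebra_simps)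
  then show "\<exists>Dr Dt. ((\<lambda>s. ?v s t) has_vector_derivative Dr) (at r) \<and>
      ((\<lambda>s. ?v r s) has_vector_derivative Dt) (at t) \<and>
      - (lam a b \<epsilon> * Dt - \<i> * complex_of_real r * Dr
      - \<i> * lam a b \<epsilon> * complex_of_real \<nu> * ?v r t + cnj (c t) * cnj (?v r t)) = 0"
    using separated_derivatives[OF assms(1)[of t] assms(2)[of t] r, of \<sigma>] by blast
qed

text \<open>With \<open>ln r = pi / (2 Im \<sigma>)\<close> the imaginary part of
  \<open>\<sigma> ln r\<close> is \<open>pi / 2\<close>. At such a radius \<open>r^\<sigma>\<close>
  and its conjugate are opposite, while at radius \<open>1\<close> they agree.\<close>

lemma rpow_imaginary_multiple:
  assumes "Im \<sigma> \<noteq> 0"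
  obtains r R where "r > 0" "R > 0" "rpow r \<sigma> = \<i> * complex_of_real R"
proof
  let ?x = "pi / (2 * Im \<sigma>)"
  show "rpow (exp ?x) \<sigma> = \<i> * complex_of_real (exp (Re \<sigma> * ?x))"
    using assms by (simp add: rpow_eq_exp complex_eq_iff Re_exp Im_exp)
qed auto

text \<open>Two radii at which \<open>r\<^sup>\<sigma>\<close> equals \<open>1\<close> and \<open>\<i>R\<close> suffice to recover both profiles from \<open>w\<close>.\<close>

lemma L_sol_profile_system:
  assumes L: "L_sol a b \<nu> c \<epsilon> w" and \<sigma>: "Im \<sigma> \<noteq> 0" and l: "lam a b \<epsilon> \<noteq> 0"
    and w: "\<And>r t. r > 0 \<Longrightarrow> w r t = rpow r \<sigma> * \<phi> t + cnj (rpow r \<sigma> * \<psi> t)"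
  shows "(\<phi> has_vector_derivative
      \<i> * (\<sigma> / lam a b \<epsilon> - \<nu>) * \<phi> t + c t / lam a b \<epsilon> * \<psi> t) (at t)"
    and "(\<psi> has_vector_derivative
      cnj (c t / lam a b \<epsilon>) * \<phi> t + - \<i> * (\<sigma> / cnj (lam a b \<epsilon>) - \<nu>) * \<psi> t) (at t)"
proof -
  obtain r R where r: "r > 0" "R > 0" "rpow r \<sigma> = \<i> * complex_of_real R"
    using rpow_imaginary_multiple[OF \<sigma>] by blast
  have diff: "\<exists>d. ((\<lambda>s. w r s) has_vector_derivative d) (at t)" if "r > 0" for r
    using L that unfolding L_sol_def by blast
  obtain d1 d2 where d: "((\<lambda>s. w 1 s) has_vector_derivative d1) (at t)"
    "((\<lambda>s. w r s) has_vector_derivative d2) (at t)"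
    using diff[of 1] diff[OF r(1)] by auto
  \<comment> \<open>At the two radii \<open>w\<close> equals \<open>\<phi> + cnj \<psi>\<close> and
    \<open>\<i> R (\<phi> - cnj \<psi>)\<close>. Solving for the profiles transfers
    differentiability in \<open>t\<close> from \<open>w\<close> to them.\<close>
  have "\<phi> = (\<lambda>s. (w 1 s + w r s * inverse (\<i> * R)) * (1/2))"
    and "\<psi> = (\<lambda>s. cnj ((w 1 s - w r s * inverse (\<i> * R)) * (1/2)))"
    using r by (auto simp: w fun_eq_iff field_simps)
  moreover have "((\<lambda>s. (w 1 s + w r s * inverse (\<i> * R)) * (1/2)) has_vector_derivative
      (d1 + d2 * inverse (\<i> * R)) * (1/2)) (at t)"
    and "((\<lambda>s. cnj ((w 1 s - w r s * inverse (\<i> * R)) * (1/2))) has_vector_derivative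
      cnj ((d1 - d2 * inverse (\<i> * R)) * (1/2))) (at t)"
    by (intro has_vector_derivative_mult_left has_vector_derivative_add has_vector_derivative_diff
        has_vector_derivative_cnj d)+
  ultimately obtain \<phi>' \<psi>' where \<phi>': "(\<phi> has_vector_derivative \<phi>') (at t)"
    and \<psi>': "(\<psi> has_vector_derivative \<psi>') (at t)"
    by metis
  define P where "P = lam a b \<epsilon> * \<phi>' - \<i> * \<sigma> * \<phi> t + \<i> * lam a b \<epsilon> * \<nu> * \<phi> t - c t * \<psi> t"
  define Q where "Q = lam a b \<epsilon> * cnj \<psi>' - \<i> * cnj \<sigma> * cnj (\<psi> t)
        + \<i> * lam a b \<epsilon> * \<nu> * cnj (\<psi> t) - c t * cnj (\<phi> t)"
  have PQ: "rpow s \<sigma> * P + cnj (rpow s \<sigma>) * Q = 0" if "s > 0" for s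
    unfolding P_def Q_def by (rule L_sol_separated[OF L that w \<phi>' \<psi>'])
  \<comment> \<open>The same two radii give \<open>P + Q = 0\<close> and \<open>P - Q = 0\<close>,
    so both brackets vanish.\<close>
  have "P + Q = 0" using PQ[of 1] by simp
  moreover have "(\<i> * R) * (P - Q) = 0" using PQ[OF r(1)] r by (simp add: algebra_simps)
  ultimately have "P = 0" "Q = 0" using r(2) by auto
  from \<open>P = 0\<close> have "\<phi>' = \<i> * (\<sigma> / lam a b \<epsilon> - \<nu>) * \<phi> t + c t / lam a b \<epsilon> * \<psi> t"
    using l by (simp add: P_def field_simps)
  then show "(\<phi> has_vector_derivative
      \<i> * (\<sigma> / lam a b \<epsilon> - \<nu>) * \<phi> t + c t / lam a b \<epsilon> * \<psi> t) (at t)"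
    using \<phi>' by simp
  have "cnj Q = 0" using \<open>Q = 0\<close> by simp
  then have "\<psi>' = cnj (c t / lam a b \<epsilon>) * \<phi> t + - \<i> * (\<sigma> / cnj (lam a b \<epsilon>) - \<nu>) * \<psi> t"
    using l by (simp add: Q_def field_simps)
  then show "(\<psi> has_vector_derivative
      cnj (c t / lam a b \<epsilon>) * \<phi> t + - \<i> * (\<sigma> / cnj (lam a b \<epsilon>) - \<nu>) * \<psi> t) (at t)"
    using \<psi>' by simp
qed

section \<open>Adjoint basic solutions for non-real and for real exponents\<close>

lemma basic_sol_Lstar_nonreal:
  assumes L: "L_sol a b \<nu> c \<epsilon> w" and \<sigma>: "Im \<sigma> \<noteq> 0" and "a > 0"
    and c: "continuous_on UNIV c" "periodic2pi c" and char: "has_char w \<sigma> j"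
  obtains X Z where "Lstar_sol a b \<nu> c \<epsilon> (\<lambda>r t. rpow r (- \<sigma>) * X t + cnj (rpow r (- \<sigma>) * Z t))"
    "periodic2pi X" "periodic2pi Z" "\<And>t. norm (Z t) < norm (X t)" "winding_num X (- j)"
proof -
  obtain \<phi> \<psi> where per: "periodic2pi \<phi>" "periodic2pi \<psi>"
    and w: "\<And>r t. r > 0 \<Longrightarrow> w r t = rpow r \<sigma> * \<phi> t + cnj (rpow r \<sigma> * \<psi> t)"
    and less: "\<And>t. norm (\<psi> t) < norm (\<phi> t)" and wind: "winding_num \<phi> j"
    using char \<sigma> unfolding has_char_def by auto
  define l where "l = lam a b \<epsilon>"
  have Rel: "Re l = a" by (simp add: l_def lam_def)
  then have l: "l \<noteq> 0" using \<open>a > 0\<close> by auto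
  define A where "A = \<i> * (\<sigma> / l - \<nu>)"
  define D where "D = - \<i> * (\<sigma> / cnj l - \<nu>)"
  \<comment> \<open>The aim is \<open>Re (A - D) = - 2 a Im \<sigma> / (norm l)\<^sup>2\<close>,
    which is nonzero because \<open>a > 0\<close> and \<open>\<sigma>\<close> is not real.\<close>
  have "A - D = \<i> * (\<sigma> * (2 * a) / (l * cnj l) - 2 * \<nu>)"
  proof -
    have "complex_of_real (2 * a) = l + cnj l" by (simp add: complex_add_cnj Rel)
    then have "\<sigma> * (2 * a) / (l * cnj l) = \<sigma> / l + \<sigma> / cnj l"
      using l by (simp add: field_simps)
    then show ?thesis by (simp add: A_def D_def algebra_simps)
  qed
  also have "l * cnj l = complex_of_real ((norm l)\<^sup>2)"
    by (simp add: complex_norm_square[symmetric])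
  finally have "Re (A - D) = - (Im \<sigma> * (2 * a) / (norm l)\<^sup>2)"
    by (simp add: Im_divide_of_real del: of_real_power)
  then have AD: "Re A \<noteq> Re D" using \<sigma> \<open>a > 0\<close> l by auto
  note sys = L_sol_profile_system[OF L \<sigma> l[unfolded l_def] w, folded l_def, folded A_def D_def]
  have B: "continuous_on UNIV (\<lambda>t. c t / l)" "periodic2pi (\<lambda>t. c t / l)"
    using c l by (auto intro!: continuous_intros simp: periodic2pi_def)
  obtain p q where pq: "periodic2pi p" "periodic2pi q"
    "\<And>t. (p has_vector_derivative - A * p t - cnj (c t / l) * q t) (at t)"
    "\<And>t. (q has_vector_derivative - (c t / l) * p t - D * q t) (at t)"
    "\<And>t. norm (q t) < norm (p t)" "\<And>t. Re (p t * \<phi> t) > 0"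
    by (rule periodic_adjoint_dominant[OF per B(2,1) sys less AD]) blast+
  \<comment> \<open>Scaling by \<open>l\<close> and \<open>cnj l\<close> turns the profile equations
    of the adjoint operator into exactly the negative transpose of the system for
    \<open>(\<phi>, \<psi>)\<close>. The two factors have equal modulus, so the domination of
    \<open>q\<close> by \<open>p\<close> passes to \<open>?Z\<close> and \<open>?X\<close>.\<close>
  let ?X = "\<lambda>t. inverse l * p t" and ?Z = "\<lambda>t. inverse (cnj l) * q t"
  show thesis
  proof (rule that)
    show "Lstar_sol a b \<nu> c \<epsilon> (\<lambda>r t. rpow r (- \<sigma>) * ?X t + cnj (rpow r (- \<sigma>) * ?Z t))"
    proof (rule Lstar_sol_separated)
      fix t
      show "(?X has_vector_derivative inverse l * (- A * p t - cnj (c t / l) * q t)) (at t)"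
        "(?Z has_vector_derivative inverse (cnj l) * (- (c t / l) * p t - D * q t)) (at t)"
        by (intro has_vector_derivative_mult_right pq)+
      have "lam a b \<epsilon> * (inverse l * (- A * p t - cnj (c t / l) * q t)) - \<i> * - \<sigma> * ?X t
          - \<i> * lam a b \<epsilon> * \<nu> * ?X t + cnj (c t) * ?Z t = 0"
        using l unfolding l_def[symmetric] A_def by (simp add: field_simps)
      moreover have "lam a b \<epsilon> * cnj (inverse (cnj l) * (- (c t / l) * p t - D * q t))
          - \<i> * cnj (- \<sigma>) * cnj (?Z t) - \<i> * lam a b \<epsilon> * \<nu> * cnj (?Z t) + cnj (c t) * cnj (?X t) = 0"
        using l unfolding l_def[symmetric] D_def by (simp add: field_simps)
      ultimately show "rpow r (- \<sigma>) * (lam a b \<epsilon> * (inverse l * (- A * p t - cnj (c t / l) * q t))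
          - \<i> * - \<sigma> * ?X t - \<i> * lam a b \<epsilon> * \<nu> * ?X t + cnj (c t) * ?Z t)
        + cnj (rpow r (- \<sigma>)) * (lam a b \<epsilon> * cnj (inverse (cnj l) * (- (c t / l) * p t - D * q t))
          - \<i> * cnj (- \<sigma>) * cnj (?Z t) - \<i> * lam a b \<epsilon> * \<nu> * cnj (?Z t) + cnj (c t) * cnj (?X t)) = 0" for r
        by (simp only: mult_zero_right add_0)
    qed
    show "periodic2pi ?X" "periodic2pi ?Z" using pq(1,2) by (simp_all add: periodic2pi_def)
    show "norm (?Z t) < norm (?X t)" for t
      using pq(5)[of t] l by (simp add: norm_mult norm_inverse)
    have cont: "continuous_on UNIV p" "continuous_on UNIV \<phi>"
      using has_vector_derivative_imp_continuous_on_UNIV[OF pq(3)] wind by (auto simp: winding_num_def)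
    show "winding_num ?X (- j)"
    proof (rule winding_num_reciprocal[OF wind _ _ _ _ l])
      show "periodic2pi (\<lambda>t. p t * \<phi> t)" using pq(1) per by (simp add: periodic2pi_def)
      show "continuous_on UNIV ?X" "continuous_on UNIV (\<lambda>t. p t * \<phi> t)"
        by (intro continuous_intros cont)+
      show "p t * \<phi> t \<notin> \<real>\<^sub>\<le>\<^sub>0" for t
        using pq(6)[of t] by (auto simp: complex_nonpos_Reals_iff)
    qed (use l in auto)
  qed
qed

lemma basic_sol_Lstar_real:
  assumes L: "L_sol a b \<nu> c \<epsilon> w" and \<sigma>: "Im \<sigma> = 0" and "a > 0"
    and c: "continuous_on UNIV c" "periodic2pi c" and char: "has_char w \<sigma> j"
  obtains X where "Lstar_sol a b \<nu> c \<epsilon> (\<lambda>r t. rpow r (- \<sigma>) * X t + cnj (rpow r (- \<sigma>) * 0))"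
    "periodic2pi X" "\<And>t. X t \<noteq> 0" "winding_num X (- j)"
proof -
  obtain f where per: "periodic2pi f"
    and w: "\<And>r t. r > 0 \<Longrightarrow> w r t = rpow r \<sigma> * f t"
    and f0: "\<And>t. f t \<noteq> 0" and wind: "winding_num f j"
    using char \<sigma> unfolding has_char_def by auto
  define l where "l = lam a b \<epsilon>"
  have Rel: "Re l = a" by (simp add: l_def lam_def)
  then have l: "l \<noteq> 0" using \<open>a > 0\<close> by auto
  have real: "cnj \<sigma> = \<sigma>" using \<sigma> by (simp add: complex_eq_iff)
  define A where "A = \<i> * (\<sigma> / l - \<nu>)"
  have f': "(f has_vector_derivative A * f t + c t / l * cnj (f t)) (at t)" for t
  proof -
    obtain f' where f': "(f has_vector_derivative f') (at t)"
    proof -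
      obtain d where "((\<lambda>s. w 1 s) has_vector_derivative d) (at t)"
        using L unfolding L_sol_def by (meson zero_less_one)
      moreover have "(\<lambda>s. w 1 s) = f" by (simp add: w fun_eq_iff)
      ultimately show thesis using that by simp
    qed
    \<comment> \<open>This is the separated equation at radius \<open>1\<close> with second profile
      \<open>0\<close>, where only the sum of the two brackets is available.\<close>
    have "l * f' - \<i> * \<sigma> * f t + \<i> * l * \<nu> * f t - c t * cnj (f t) = 0"
      using L_sol_separated[OF L zero_less_one, of \<sigma> f "\<lambda>_. 0" f' t 0] f' w
      by (simp add: l_def)
    then have "f' = A * f t + c t / l * cnj (f t)"
      using l by (simp add: A_def field_simps)
    then show ?thesis using f' by simp
  qed
  obtain g where g: "periodic2pi g"
    "\<And>t. (g has_vector_derivative - A * g t - cnj (c t) / l * cnj (g t)) (at t)"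
    "\<And>t. l * f t * g t \<notin> \<real>\<^sub>\<le>\<^sub>0"
    by (rule periodic_adjoint_real[OF per c(2,1) f' f0 l]) blast
  have cont: "continuous_on UNIV g" "continuous_on UNIV f"
    using has_vector_derivative_imp_continuous_on_UNIV[OF g(2)] wind by (auto simp: winding_num_def)
  show thesis
  proof (rule that)
    show "Lstar_sol a b \<nu> c \<epsilon> (\<lambda>r t. rpow r (- \<sigma>) * g t + cnj (rpow r (- \<sigma>) * 0))"
    proof (rule Lstar_sol_separated)
      fix r t :: real assume r: "r > 0"
      \<comment> \<open>Since the power is real, the term \<open>cnj c * cnj g\<close> of the second
        bracket cancels what the equation for \<open>g\<close> leaves in the first.\<close>
      have "cnj (rpow r (- \<sigma>)) = rpow r (- \<sigma>)" using r real by (simp add: rpow_eq_exp exp_cnj)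
      moreover have "l * (- A * g t - cnj (c t) / l * cnj (g t)) - \<i> * - \<sigma> * g t
          - \<i> * l * \<nu> * g t = - cnj (c t) * cnj (g t)"
        using l by (simp add: A_def field_simps)
      ultimately show "rpow r (- \<sigma>) * (lam a b \<epsilon> * (- A * g t - cnj (c t) / l * cnj (g t))
          - \<i> * - \<sigma> * g t - \<i> * lam a b \<epsilon> * \<nu> * g t + cnj (c t) * 0)
        + cnj (rpow r (- \<sigma>)) * (lam a b \<epsilon> * cnj 0 - \<i> * cnj (- \<sigma>) * cnj 0
          - \<i> * lam a b \<epsilon> * \<nu> * cnj 0 + cnj (c t) * cnj (g t)) = 0"
        unfolding l_def[symmetric] by simp
    qed (use g in auto)
    show "g t \<noteq> 0" for t using g(3)[of t] by auto
    show "winding_num g (- j)"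
    proof (rule winding_num_reciprocal[OF wind _ cont(1) _ g(3) l])
      show "periodic2pi (\<lambda>t. l * f t * g t)" using g(1) per by (simp add: periodic2pi_def)
      show "continuous_on UNIV (\<lambda>t. l * f t * g t)" by (intro continuous_intros cont)
    qed simp
  qed (rule g)
qed

theorem theorem2p2:
  fixes a b \<nu> :: real and k :: nat and c :: "real \<Rightarrow> complex"
    and \<sigma> :: "real \<Rightarrow> complex" and \<phi> \<psi> :: "real \<Rightarrow> real \<Rightarrow> complex"
    and w :: "real \<Rightarrow> real \<Rightarrow> real \<Rightarrow> complex" and j :: int
  assumes "a > 0" and "b \<noteq> 0" and "0 \<le> \<nu>" and "\<nu> < 1" and "k \<ge> 2"
    and "Ck_circle k c"
    and w_def: "\<And>\<epsilon> r t. w \<epsilon> r t = rpow r (\<sigma> \<epsilon>) * \<phi> t \<epsilon> + cnj (rpow r (\<sigma> \<epsilon>) * \<psi> t \<epsilon>)"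
    and "\<And>\<epsilon>. periodic2pi (\<lambda>t. \<phi> t \<epsilon>)" and "\<And>\<epsilon>. periodic2pi (\<lambda>t. \<psi> t \<epsilon>)"
    and "continuous_on UNIV \<sigma>"
    and "continuous_on UNIV (\<lambda>p. \<phi> (fst p) (snd p))"
    and "continuous_on UNIV (\<lambda>p. \<psi> (fst p) (snd p))"
    and "\<And>\<epsilon>. basic_sol (L_sol a b \<nu> c \<epsilon>) (w \<epsilon>)"
    and "\<And>\<epsilon>. has_char (w \<epsilon>) (\<sigma> \<epsilon>) j"
  shows "\<forall>\<epsilon>. \<exists>X Z :: real \<Rightarrow> complex.
           basic_sol (Lstar_sol a b \<nu> c \<epsilon>)
             (\<lambda>r t. rpow r (- \<sigma> \<epsilon>) * X t + cnj (rpow r (- \<sigma> \<epsilon>) * Z t)) \<and>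
           periodic2pi X \<and> periodic2pi Z \<and>
           (\<forall>t. norm (Z t) < norm (X t)) \<and>
           has_char (\<lambda>r t. rpow r (- \<sigma> \<epsilon>) * X t + cnj (rpow r (- \<sigma> \<epsilon>) * Z t))
             (- \<sigma> \<epsilon>) (- j)"
proof
  fix \<epsilon>
  obtain C where C: "C 0 = c"
    "\<And>i t. i < k \<Longrightarrow> (C i has_vector_derivative C (Suc i) t) (at t)"
    using \<open>Ck_circle k c\<close> unfolding Ck_circle_def by blast
  have c: "continuous_on UNIV c" "periodic2pi c"
    using has_vector_derivative_imp_continuous_on_UNIV[OF C(2)[of 0]] C(1) \<open>k \<ge> 2\<close> \<open>Ck_circle k c\<close>
    by (auto simp: Ck_circle_def)
  have L: "L_sol a b \<nu> c \<epsilon> (w \<epsilon>)" using assms(13)[of \<epsilon>] by (simp add: basic_sol_def)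
  have basic: "basic_sol (Lstar_sol a b \<nu> c \<epsilon>)
      (\<lambda>r t. rpow r (- \<sigma> \<epsilon>) * X t + cnj (rpow r (- \<sigma> \<epsilon>) * Z t))"
    if "Lstar_sol a b \<nu> c \<epsilon> (\<lambda>r t. rpow r (- \<sigma> \<epsilon>) * X t + cnj (rpow r (- \<sigma> \<epsilon>) * Z t))"
      "periodic2pi X" "periodic2pi Z" "\<And>t. norm (Z t) < norm (X t)" for X Z
  proof -
    \<comment> \<open>This is the value of the candidate at \<open>r = 1\<close>,
      \<open>t = 0\<close>; strict domination keeps it away from zero and so proves
      nontriviality.\<close>
    have "X 0 + cnj (Z 0) \<noteq> 0"
      using that(4)[of 0] by (metis add_eq_0_iff complex_mod_cnj norm_minus_cancel less_irrefl)
    then have "\<exists>r>0. \<exists>t. rpow r (- \<sigma> \<epsilon>) * X t + cnj (rpow r (- \<sigma> \<epsilon>) * Z t) \<noteq> 0"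
      by (intro exI[of _ 1] conjI exI[of _ 0]) auto
    then show ?thesis unfolding basic_sol_def using that(1-3) by blast
  qed
  show "\<exists>X Z. basic_sol (Lstar_sol a b \<nu> c \<epsilon>)
             (\<lambda>r t. rpow r (- \<sigma> \<epsilon>) * X t + cnj (rpow r (- \<sigma> \<epsilon>) * Z t)) \<and>
           periodic2pi X \<and> periodic2pi Z \<and>
           (\<forall>t. norm (Z t) < norm (X t)) \<and>
           has_char (\<lambda>r t. rpow r (- \<sigma> \<epsilon>) * X t + cnj (rpow r (- \<sigma> \<epsilon>) * Z t))
             (- \<sigma> \<epsilon>) (- j)"
  proof (cases "Im (\<sigma> \<epsilon>) = 0")
    case False
    obtain X Z where XZ:
      "Lstar_sol a b \<nu> c \<epsilon> (\<lambda>r t. rpow r (- \<sigma> \<epsilon>) * X t + cnj (rpow r (- \<sigma> \<epsilon>) * Z t))"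
      "periodic2pi X" "periodic2pi Z" "\<And>t. norm (Z t) < norm (X t)" "winding_num X (- j)"
      by (rule basic_sol_Lstar_nonreal[OF L False \<open>a > 0\<close> c assms(14)]) blast
    have "has_char (\<lambda>r t. rpow r (- \<sigma> \<epsilon>) * X t + cnj (rpow r (- \<sigma> \<epsilon>) * Z t)) (- \<sigma> \<epsilon>) (- j)"
      unfolding has_char_def using False XZ(2-5) by auto
    then show ?thesis using basic[OF XZ(1-4)] XZ(2-4) by blast
  next
    case True
    obtain X where X:
      "Lstar_sol a b \<nu> c \<epsilon> (\<lambda>r t. rpow r (- \<sigma> \<epsilon>) * X t + cnj (rpow r (- \<sigma> \<epsilon>) * 0))"
      "periodic2pi X" "\<And>t. X t \<noteq> 0" "winding_num X (- j)"
      by (rule basic_sol_Lstar_real[OF L True \<open>a > 0\<close> c assms(14)]) blast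
    \<comment> \<open>For a real exponent the solution is the single term
      \<open>r^(-\<sigma>) X\<close>; taking the second profile to be \<open>0\<close> fits it into
      the two-term form, and the domination says that \<open>X\<close> has no zero.\<close>
    have Z: "periodic2pi (\<lambda>_. 0 :: complex)" "\<And>t. norm (0 :: complex) < norm (X t)"
      using X(3) by (auto simp: periodic2pi_def)
    have "has_char (\<lambda>r t. rpow r (- \<sigma> \<epsilon>) * X t + cnj (rpow r (- \<sigma> \<epsilon>) * 0)) (- \<sigma> \<epsilon>) (- j)"
      unfolding has_char_def using True X(2-4) by auto
    then show ?thesis
      using basic[OF X(1,2) Z] X(2) Z by (intro exI[of _ X] exI[of _ "\<lambda>_. 0"]) auto
  qed
qed

end
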